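(* Let $R$ be a Noetherian ring, $I\subset R$ an ideal, and let $f\in R$ be an element such that $I^j:f=I^j$ for all $j\geq 0$. Then there exists an integer $k>0$ such that $(C(I),f^k)\subseteq C((I,f))$.
   Context: All rings are commutative with unit. For a Noetherian ring $R$ and an ideal $I=(f_1,\ldots,f_m)\subseteq R$, let $\mathcal{R}(I)=R[f_1t,\ldots,f_mt]\subseteq R[t]$ be the Rees algebra, $T=R[y_1,\ldots,y_m]$ a polynomial ring, $\varphi:T\to\mathcal{R}(I)$ the $R$-algebra homomorphism with $\varphi(y_j)=f_jt$, and $J=\ker\varphi$. Let $L\subseteq J$ be the ideal of $T$ generated by all linear relations $\sum_{i=1}^m a_iy_i$ with $a_i\in R$ and $\sum_i a_if_i=0$. Then $T/L\cong S(I)$ is the symmetric algebra of $I$, and the kernel of the canonical epimorphism $\alpha:S(I)\to\mathcal{R}(I)$ is $J/L$. The conductor of $I$ is the ideal $C(I)=L:_RJ=\{r\in R: rJ\subseteq L\}=\mathrm{Ann}_R(\ker\alpha)$ of $R$; it does not depend on the chosen generators. $(I,f)$ denotes the ideal generated by $I$ and $f$. *)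

theory Defs
  imports "HOL-Library.Poly_Mapping" "HOL-Computational_Algebra.Polynomial"
begin

section \<open>Ideals\<close>

text \<open>The ambient ring is a type; ideals are taken relative to a subring \<open>T\<close> of it, since the
  polynomial rings \<open>R[y\<^sub>1, \<dots>, y\<^sub>m]\<close> below are subrings of one type. The ring \<open>R\<close> itself
  is always \<open>UNIV\<close>.\<close>

definition ideal_of :: "'b::comm_ring_1 set \<Rightarrow> 'b set \<Rightarrow> bool" where
  "ideal_of T A \<longleftrightarrow> A \<subseteq> T \<and> 0 \<in> A \<and> (\<forall>x\<in>A. \<forall>y\<in>A. x + y \<in> A) \<and> (\<forall>c\<in>T. \<forall>x\<in>A. c * x \<in> A)"

definition gen_ideal_of :: "'b::comm_ring_1 set \<Rightarrow> 'b set \<Rightarrow> 'b set" where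
  "gen_ideal_of T S = ideal_of T hull S"

abbreviation is_ideal :: "'a::comm_ring_1 set \<Rightarrow> bool" where
  "is_ideal \<equiv> ideal_of UNIV"

abbreviation gen_ideal :: "'a::comm_ring_1 set \<Rightarrow> 'a set" where
  "gen_ideal \<equiv> gen_ideal_of UNIV"

definition noetherian :: "'a::comm_ring_1 itself \<Rightarrow> bool" where
  "noetherian _ \<longleftrightarrow> (\<forall>I::'a set. is_ideal I \<longrightarrow> (\<exists>S. finite S \<and> gen_ideal S = I))"

definition ideal_mult :: "'a::comm_ring_1 set \<Rightarrow> 'a set \<Rightarrow> 'a set" where
  "ideal_mult I K = gen_ideal {x * y | x y. x \<in> I \<and> y \<in> K}"

primrec ideal_pow :: "'a::comm_ring_1 set \<Rightarrow> nat \<Rightarrow> 'a set" where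
  "ideal_pow I 0 = UNIV"
| "ideal_pow I (Suc j) = ideal_mult I (ideal_pow I j)"

definition colon :: "'a::comm_ring_1 set \<Rightarrow> 'a \<Rightarrow> 'a set" where
  "colon I f = {r. r * f \<in> I}"


section \<open>Polynomial rings\<close>

text \<open>Polynomials in variables indexed by the natural numbers: a finitely supported family of
  coefficients, indexed by monomials, i.e. by finitely supported families of exponents.\<close>

type_synonym 'a mpoly = "(nat \<Rightarrow>\<^sub>0 nat) \<Rightarrow>\<^sub>0 'a"

definition Const :: "'a::comm_ring_1 \<Rightarrow> 'a mpoly" where
  "Const a = Poly_Mapping.single 0 a"

definition Var :: "nat \<Rightarrow> 'a::comm_ring_1 mpoly" where
  "Var i = Poly_Mapping.single (Poly_Mapping.single i 1) 1"

text \<open>The subring of polynomials in the first \<open>m\<close> variables.\<close>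

definition polys :: "nat \<Rightarrow> 'a::comm_ring_1 mpoly set" where
  "polys m = {P. \<forall>k\<in>Poly_Mapping.keys P. Poly_Mapping.keys k \<subseteq> {..<m}}"

text \<open>For a ring homomorphism \<open>h\<close>, the extension of \<open>h\<close> to polynomials sending the
  \<open>i\<close>-th variable to \<open>g i\<close>.\<close>

definition subst :: "('a::comm_ring_1 \<Rightarrow> 'b::comm_ring_1) \<Rightarrow> (nat \<Rightarrow> 'b) \<Rightarrow> 'a mpoly \<Rightarrow> 'b" where
  "subst h g P = (\<Sum>k\<in>Poly_Mapping.keys P.
     h (Poly_Mapping.lookup P k) * (\<Prod>i\<in>Poly_Mapping.keys k. g i ^ Poly_Mapping.lookup k i))"


section \<open>The conductor\<close>

text \<open>Throughout, \<open>fs\<close> lists generators \<open>f\<^sub>0, \<dots>, f\<^bsub>m-1\<^esub>\<close> of an ideal. The Rees algebra is a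
  subring of \<open>R[t]\<close>, so the kernel of the map onto it is computed in \<open>R[t]\<close>;
  here \<open>monom a 1\<close> is \<open>a t\<close>.\<close>

definition rees_map :: "'a::comm_ring_1 list \<Rightarrow> 'a mpoly \<Rightarrow> 'a poly" where
  "rees_map fs = subst (\<lambda>a. [:a:]) (\<lambda>i. monom (fs ! i) 1)"

definition rees_ideal :: "'a::comm_ring_1 list \<Rightarrow> 'a mpoly set" where
  "rees_ideal fs = {P \<in> polys (length fs). rees_map fs P = 0}"

definition linear_relations :: "'a::comm_ring_1 list \<Rightarrow> 'a mpoly set" where
  "linear_relations fs =
     {\<Sum>i<length fs. Const (a i) * Var i | a. (\<Sum>i<length fs. a i * fs ! i) = 0}"

definition sym_ideal :: "'a::comm_ring_1 list \<Rightarrow> 'a mpoly set" where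
  "sym_ideal fs = gen_ideal_of (polys (length fs)) (linear_relations fs)"

definition conductor_wrt :: "'a::comm_ring_1 list \<Rightarrow> 'a set" where
  "conductor_wrt fs = {r. \<forall>P\<in>rees_ideal fs. Const r * P \<in> sym_ideal fs}"

text \<open>The choice of generators is immaterial, see \<open>conductor_eq\<close> below. The value is meaningful
  for finitely generated ideals only.\<close>

definition conductor :: "'a::comm_ring_1 set \<Rightarrow> 'a set" where
  "conductor I = conductor_wrt (SOME fs. gen_ideal (set fs) = I)"


section \<open>Independence of the generators\<close>

lemma ideal_of_gen_ideal_of:
  assumes "ideal_of T T" "S \<subseteq> T"
  shows "ideal_of T (gen_ideal_of T S)"
proof -
  have "gen_ideal_of T S \<subseteq> T"
    unfolding gen_ideal_of_def by (rule hull_minimal) (use assms in auto)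
  then show ?thesis
    unfolding ideal_of_def gen_ideal_of_def hull_def by blast
qed

lemma ideal_of_UNIV [simp]: "is_ideal UNIV"
  by (simp add: ideal_of_def)

lemma gen_ideal_of_superset: "S \<subseteq> gen_ideal_of T S"
  unfolding gen_ideal_of_def by (rule hull_subset)

lemma gen_ideal_of_minimal: "S \<subseteq> A \<Longrightarrow> ideal_of T A \<Longrightarrow> gen_ideal_of T S \<subseteq> A"
  unfolding gen_ideal_of_def by (rule hull_minimal)

lemma ideal_of_sum:
  assumes "ideal_of T A" "\<And>i. i \<in> X \<Longrightarrow> F i \<in> A"
  shows "sum F X \<in> A"
  using assms(2) by (induction X rule: infinite_finite_induct) (use assms(1) in \<open>auto simp: ideal_of_def\<close>)

lemma mem_gen_ideal_list:
  assumes "x \<in> gen_ideal (set gs)"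
  shows "\<exists>a. x = (\<Sum>j<length gs. a j * gs ! j)"
proof -
  let ?A = "{x. \<exists>a. x = (\<Sum>j<length gs. a j * gs ! j)}"
  have "set gs \<subseteq> ?A"
  proof
    fix x assume "x \<in> set gs"
    then obtain j where j: "j < length gs" "x = gs ! j" by (auto simp: in_set_conv_nth)
    have "(\<Sum>i<length gs. (if i = j then 1 else 0) * gs ! i) = (\<Sum>i<length gs. if i = j then gs ! i else 0)"
      by (intro sum.cong) auto
    also have "\<dots> = x" using j by simp
    finally show "x \<in> ?A" by (intro CollectI exI) (rule sym)
  qed
  moreover have "is_ideal ?A"
    unfolding ideal_of_def
  proof (intro conjI ballI)
    show "0 \<in> ?A" by (auto intro!: exI[of _ "\<lambda>_. 0"])
  next
    fix x y assume "x \<in> ?A" "y \<in> ?A"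
    then obtain a b where "x = (\<Sum>j<length gs. a j * gs ! j)" "y = (\<Sum>j<length gs. b j * gs ! j)"
      by blast
    then have "x + y = (\<Sum>j<length gs. (a j + b j) * gs ! j)"
      by (simp add: sum.distrib distrib_right)
    then show "x + y \<in> ?A" by (intro CollectI exI)
  next
    fix c x assume "x \<in> ?A"
    then obtain a where "x = (\<Sum>j<length gs. a j * gs ! j)" by blast
    then have "c * x = (\<Sum>j<length gs. (c * a j) * gs ! j)"
      by (simp add: sum_distrib_left mult.assoc)
    then show "c * x \<in> ?A" by (intro CollectI exI)
  qed simp
  ultimately show ?thesis using gen_ideal_of_minimal[of "set gs" ?A UNIV] assms by blast
qed

lemma mpoly_induct [case_names zero single add]:
  fixes P :: "'k \<Rightarrow>\<^sub>0 'b::comm_monoid_add"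
  assumes "Q 0" "\<And>k c. c \<noteq> 0 \<Longrightarrow> k \<in> Poly_Mapping.keys P \<Longrightarrow> Q (Poly_Mapping.single k c)"
    and "\<And>p q. Q p \<Longrightarrow> Q q \<Longrightarrow> Q (p + q)"
  shows "Q P"
proof -
  have expand: "P = (\<Sum>k\<in>Poly_Mapping.keys P. Poly_Mapping.single k (Poly_Mapping.lookup P k))"
    by (rule poly_mapping_eqI)
      (auto simp: lookup_sum lookup_single when_def in_keys_iff sum.delta')
  have "Q (\<Sum>k\<in>X. Poly_Mapping.single k (Poly_Mapping.lookup P k))"
    if "finite X" "X \<subseteq> Poly_Mapping.keys P" for X
    using that by (induction X rule: finite_induct) (auto intro!: assms simp: in_keys_iff)
  from this[of "Poly_Mapping.keys P"] show ?thesis using expand by simp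
qed

locale ring_hom_1 =
  fixes h :: "'a::comm_ring_1 \<Rightarrow> 'b::comm_ring_1"
  assumes hom_add: "h (x + y) = h x + h y"
    and hom_mult: "h (x * y) = h x * h y"
    and hom_one: "h 1 = 1"
begin

lemma hom_zero: "h 0 = 0"
  using hom_add[of 0 0] by simp

lemma hom_diff: "h (x - y) = h x - h y"
  using hom_add[of "x - y" y] by (simp add: algebra_simps)

lemma hom_sum: "h (sum F X) = (\<Sum>i\<in>X. h (F i))"
  by (induction X rule: infinite_finite_induct) (auto simp: hom_zero hom_add)

lemma hom_power: "h (x ^ n) = h x ^ n"
  by (induction n) (auto simp: hom_one hom_mult)

lemma hom_prod: "h (prod F X) = (\<Prod>i\<in>X. h (F i))"
  by (induction X rule: infinite_finite_induct) (auto simp: hom_one hom_mult)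

lemma subst_superset:
  assumes "finite X" "Poly_Mapping.keys P \<subseteq> X"
  shows "subst h g P = (\<Sum>k\<in>X. h (Poly_Mapping.lookup P k) *
           (\<Prod>i\<in>Poly_Mapping.keys k. g i ^ Poly_Mapping.lookup k i))"
  unfolding subst_def by (rule sum.mono_neutral_left) (use assms in \<open>auto simp: hom_zero in_keys_iff\<close>)

lemma subst_zero: "subst h g 0 = 0"
  by (simp add: subst_def)

lemma subst_add: "subst h g (P + Q) = subst h g P + subst h g Q"
proof -
  let ?X = "Poly_Mapping.keys P \<union> Poly_Mapping.keys Q"
  show ?thesis
    using subst_superset[of ?X P] subst_superset[of ?X Q] subst_superset[of ?X "P + Q"] keys_add[of P Q]
    by (simp add: lookup_add hom_add distrib_right sum.distrib)
qed

lemma subst_single: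
  "subst h g (Poly_Mapping.single k c) =
     h c * (\<Prod>i\<in>Poly_Mapping.keys k. g i ^ Poly_Mapping.lookup k i)"
  by (subst subst_superset[of "{k}"]) auto

lemma subst_mult: "subst h g (P * Q) = subst h g P * subst h g Q"
proof (induction P rule: mpoly_induct)
  case (single k c)
  show ?case
  proof (induction Q rule: mpoly_induct)
    case (single l d)
    let ?X = "Poly_Mapping.keys k \<union> Poly_Mapping.keys l"
    have pr: "(\<Prod>i\<in>Poly_Mapping.keys n. g i ^ Poly_Mapping.lookup n i) =
        (\<Prod>i\<in>?X. g i ^ Poly_Mapping.lookup n i)" if "Poly_Mapping.keys n \<subseteq> ?X" for n
      by (rule prod.mono_neutral_left) (use that in \<open>auto simp: in_keys_iff\<close>)
    show ?case
      using pr[of k] pr[of l] pr[of "k + l"] keys_add[of k l]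
      by (simp add: mult_single subst_single hom_mult lookup_add power_add prod.distrib mult_ac)
  qed (auto simp: subst_zero subst_add distrib_left)
qed (auto simp: subst_zero subst_add distrib_right)

lemma subst_Const: "subst h g (Const c) = h c"
  by (simp add: Const_def subst_single)

lemma subst_Var: "subst h g (Var i) = g i"
  by (simp add: Var_def subst_single hom_one)

lemma ring_hom_subst: "ring_hom_1 (subst h g)"
  using subst_Const[of g 1] by unfold_locales (auto simp: subst_add subst_mult hom_one Const_def)

end

lemma mpoly_closure:
  assumes "P \<in> polys m"
    and const: "\<And>c. Q (Const c)" and var: "\<And>i. i < m \<Longrightarrow> Q (Var i)"
    and add: "\<And>p q. Q p \<Longrightarrow> Q q \<Longrightarrow> Q (p + q)" and mult: "\<And>p q. Q p \<Longrightarrow> Q q \<Longrightarrow> Q (p * q)"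
  shows "Q P"
proof (induction P rule: mpoly_induct)
  case zero
  show ?case using const[of 0] by (simp add: Const_def)
next
  case (single k c)
  then have k: "Poly_Mapping.keys k \<subseteq> {..<m}" using assms(1) by (auto simp: polys_def)
  have "Q (Poly_Mapping.single k 1)"
  proof (rule mpoly_induct[of "\<lambda>k. Q (Poly_Mapping.single k 1)" k])
    show "Q (Poly_Mapping.single 0 1)" using const[of 1] by (simp add: Const_def)
  next
    fix i n assume "n \<noteq> (0::nat)" "i \<in> Poly_Mapping.keys k"
    then have i: "i < m" using k by auto
    show "Q (Poly_Mapping.single (Poly_Mapping.single i n) 1)"
    proof (induction n)
      case 0
      show ?case using const[of 1] by (simp add: Const_def)
    next
      case (Suc n)
      have "Poly_Mapping.single (Poly_Mapping.single i (Suc n)) 1 =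
          Var i * Poly_Mapping.single (Poly_Mapping.single i n) (1::'a)"
        by (simp add: Var_def mult_single flip: single_add)
      then show ?case using mult[OF var[OF i] Suc] by simp
    qed
  next
    fix k l assume *: "Q (Poly_Mapping.single k 1)" "Q (Poly_Mapping.single l 1)"
    show "Q (Poly_Mapping.single (k + l) 1)" using mult[OF *] by (simp add: mult_single)
  qed
  from mult[OF const[of c] this] show ?case by (simp add: Const_def mult_single)
qed (rule add)

lemma polys_Const [simp]: "Const c \<in> polys m"
  by (auto simp: polys_def Const_def)

lemma polys_Var: "i < m \<Longrightarrow> Var i \<in> polys m"
  by (auto simp: polys_def Var_def)

lemma polys_zero [simp]: "0 \<in> polys m"
  by (simp add: polys_def)

lemma polys_add: "P \<in> polys m \<Longrightarrow> Q \<in> polys m \<Longrightarrow> P + Q \<in> polys m"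
  using keys_add[of P Q] by (auto simp: polys_def)

lemma polys_mult:
  assumes "P \<in> polys m" "Q \<in> polys m"
  shows "P * Q \<in> polys m"
  unfolding polys_def
proof safe
  fix n i assume n: "n \<in> Poly_Mapping.keys (P * Q)" and i: "i \<in> Poly_Mapping.keys n"
  obtain k l where "k \<in> Poly_Mapping.keys P" "l \<in> Poly_Mapping.keys Q" "n = k + l"
    using keys_mult[of P Q] n by blast
  then have "i \<in> Poly_Mapping.keys k \<union> Poly_Mapping.keys l" using i keys_add[of k l] by blast
  with \<open>k \<in> _\<close> \<open>l \<in> _\<close> show "i < m" using assms by (auto simp: polys_def)
qed

lemma ideal_of_polys: "ideal_of (polys m) (polys m)"
  by (auto simp: ideal_of_def polys_add polys_mult)

lemma polys_sum: "(\<And>i. i \<in> X \<Longrightarrow> F i \<in> polys m) \<Longrightarrow> sum F X \<in> polys m"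
  by (rule ideal_of_sum[OF ideal_of_polys])

lemma linear_relations_subset: "linear_relations fs \<subseteq> polys (length fs)"
  by (auto simp: linear_relations_def intro!: polys_sum polys_mult polys_Var)

lemma ideal_of_sym_ideal: "ideal_of (polys (length fs)) (sym_ideal fs)"
  unfolding sym_ideal_def by (intro ideal_of_gen_ideal_of ideal_of_polys linear_relations_subset)

lemma Const_add: "Const (a + b) = Const a + Const b"
  by (simp add: Const_def single_add)

lemma Const_mult: "Const (a * b) = Const a * Const b"
  by (simp add: Const_def mult_single)

interpretation Const: ring_hom_1 Const
  by unfold_locales (auto simp: Const_add Const_mult, simp add: Const_def)

interpretation pconst: ring_hom_1 "\<lambda>a::'a::comm_ring_1. [:a:]"
  by unfold_locales auto

definition subst_mat :: "(nat \<Rightarrow> nat \<Rightarrow> 'a) \<Rightarrow> nat \<Rightarrow> 'a::comm_ring_1 mpoly \<Rightarrow> 'a mpoly" where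
  "subst_mat a n = subst Const (\<lambda>i. \<Sum>j<n. Const (a i j) * Var j)"

interpretation subst_mat: ring_hom_1 "subst_mat a n"
  unfolding subst_mat_def by (rule Const.ring_hom_subst)

interpretation rees_map: ring_hom_1 "rees_map fs"
  unfolding rees_map_def by (rule pconst.ring_hom_subst)

lemma subst_mat_Const [simp]: "subst_mat a n (Const c) = Const c"
  by (simp add: subst_mat_def Const.subst_Const)

lemma subst_mat_Var: "subst_mat a n (Var i) = (\<Sum>j<n. Const (a i j) * Var j)"
  by (simp add: subst_mat_def Const.subst_Var)

lemma rees_map_Const: "rees_map fs (Const c) = [:c:]"
  by (simp add: rees_map_def pconst.subst_Const)

lemma rees_map_Var: "rees_map fs (Var i) = monom (fs ! i) 1"
  by (simp add: rees_map_def pconst.subst_Var)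

lemma subst_mat_polys:
  assumes "P \<in> polys m" shows "subst_mat a n P \<in> polys n"
  using assms
  by (rule mpoly_closure)
    (auto simp: subst_mat.hom_add subst_mat.hom_mult polys_add polys_mult subst_mat_Var polys_Var
          intro!: polys_sum)

lemma rees_map_linear:
  "rees_map fs (\<Sum>i<n. Const (a i) * Var i) = monom (\<Sum>i<n. a i * fs ! i) 1"
  by (simp add: rees_map.hom_sum rees_map.hom_mult rees_map_Const rees_map_Var smult_monom
      flip: monom_sum)

lemma subst_mat_linear:
  "subst_mat a n (\<Sum>i<m. Const (c i) * Var i) = (\<Sum>j<n. Const (\<Sum>i<m. c i * a i j) * Var j)"
proof -
  have "subst_mat a n (\<Sum>i<m. Const (c i) * Var i) = (\<Sum>i<m. \<Sum>j<n. Const (c i * a i j) * Var j)"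
    by (simp add: subst_mat.hom_sum subst_mat.hom_mult subst_mat_Var sum_distrib_left Const_mult mult.assoc)
  also have "\<dots> = (\<Sum>j<n. \<Sum>i<m. Const (c i * a i j) * Var j)"
    by (rule sum.swap)
  finally show ?thesis by (simp add: Const.hom_sum sum_distrib_right)
qed

text \<open>If \<open>f\<^sub>i = \<Sum>\<^sub>j a\<^sub>i\<^sub>j g\<^sub>j\<close>, then \<open>y\<^sub>i \<mapsto> \<Sum>\<^sub>j a\<^sub>i\<^sub>j z\<^sub>j\<close> is compatible with
  both the maps to \<open>R[t]\<close> and the linear relations.\<close>

context
  fixes fs gs :: "'a::comm_ring_1 list" and a :: "nat \<Rightarrow> nat \<Rightarrow> 'a"
  assumes a: "\<And>i. i < length fs \<Longrightarrow> fs ! i = (\<Sum>j<length gs. a i j * gs ! j)"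
begin

lemma rees_map_subst_mat:
  assumes "P \<in> polys (length fs)"
  shows "rees_map gs (subst_mat a (length gs) P) = rees_map fs P"
  using assms
  by (rule mpoly_closure)
    (auto simp: subst_mat.hom_add subst_mat.hom_mult rees_map.hom_add rees_map.hom_mult rees_map_Const
        subst_mat_Var rees_map_linear rees_map_Var a)

lemma subst_mat_sym_ideal:
  assumes "P \<in> sym_ideal fs"
  shows "subst_mat a (length gs) P \<in> sym_ideal gs"
proof -
  let ?A = "{P \<in> polys (length fs). subst_mat a (length gs) P \<in> sym_ideal gs}"
  have "linear_relations fs \<subseteq> ?A"
  proof
    fix P assume P: "P \<in> linear_relations fs"
    then obtain c where c: "P = (\<Sum>i<length fs. Const (c i) * Var i)" "(\<Sum>i<length fs. c i * fs ! i) = 0"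
      by (auto simp: linear_relations_def)
    let ?b = "\<lambda>j. \<Sum>i<length fs. c i * a i j"
    have "(\<Sum>j<length gs. ?b j * gs ! j) = (\<Sum>j<length gs. \<Sum>i<length fs. c i * (a i j * gs ! j))"
      by (simp add: sum_distrib_right mult.assoc)
    also have "\<dots> = (\<Sum>i<length fs. c i * (\<Sum>j<length gs. a i j * gs ! j))"
      by (subst sum.swap) (simp add: sum_distrib_left)
    also have "\<dots> = 0" using c(2) a by simp
    finally have "subst_mat a (length gs) P \<in> linear_relations gs"
      unfolding c(1) subst_mat_linear linear_relations_def by (intro CollectI exI[of _ ?b]) simp
    then show "P \<in> ?A"
      using P linear_relations_subset gen_ideal_of_superset unfolding sym_ideal_def by blast
  qed
  moreover have "ideal_of (polys (length fs)) ?A"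
    using ideal_of_polys[of "length fs"] ideal_of_sym_ideal[of gs] subst_mat_polys[of _ "length fs" a "length gs"]
    by (auto simp: ideal_of_def subst_mat.hom_add subst_mat.hom_mult subst_mat.hom_zero)
  ultimately show ?thesis
    using gen_ideal_of_minimal assms unfolding sym_ideal_def by blast
qed

end

lemma conductor_wrt_mono:
  assumes "gen_ideal (set fs) = gen_ideal (set gs)"
  shows "conductor_wrt gs \<subseteq> conductor_wrt fs"
proof
  fix r assume r: "r \<in> conductor_wrt gs"
  have "\<forall>i. \<exists>a. i < length fs \<longrightarrow> fs ! i = (\<Sum>j<length gs. a j * gs ! j)"
    using mem_gen_ideal_list gen_ideal_of_superset[of "set fs" UNIV] assms nth_mem by blast
  then obtain a where a: "\<And>i. i < length fs \<Longrightarrow> fs ! i = (\<Sum>j<length gs. a i j * gs ! j)"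
    by metis
  have "\<forall>i. \<exists>a. i < length gs \<longrightarrow> gs ! i = (\<Sum>j<length fs. a j * fs ! j)"
    using mem_gen_ideal_list gen_ideal_of_superset[of "set gs" UNIV] assms nth_mem by blast
  then obtain b where b: "\<And>i. i < length gs \<Longrightarrow> gs ! i = (\<Sum>j<length fs. b i j * fs ! j)"
    by metis
  let ?\<psi> = "subst_mat a (length gs)" and ?\<chi> = "subst_mat b (length fs)"
  note L = ideal_of_sym_ideal[of fs, unfolded ideal_of_def]
  have retract: "P - ?\<chi> (?\<psi> P) \<in> sym_ideal fs" if "P \<in> polys (length fs)" for P
  proof -
    have "P \<in> polys (length fs) \<and> P - ?\<chi> (?\<psi> P) \<in> sym_ideal fs"
      using that
    proof (rule mpoly_closure)
      fix c show "Const c \<in> polys (length fs) \<and> Const c - ?\<chi> (?\<psi> (Const c)) \<in> sym_ideal fs"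
        using L by simp
    next
      fix i assume i: "i < length fs"
      let ?c = "\<lambda>l. (if l = i then 1 else 0) - (\<Sum>j<length gs. a i j * b j l)"
      have "Var i = (\<Sum>l<length fs. if l = i then Var l else 0 :: 'a mpoly)"
        using i by simp
      also have "\<dots> = (\<Sum>l<length fs. Const (if l = i then 1 else 0) * Var l)"
        by (rule sum.cong) (auto simp: Const.hom_one Const.hom_zero)
      finally have 0: "(\<Sum>l<length fs. Const (if l = i then 1 else 0) * Var l) = (Var i :: 'a mpoly)" ..
      have "?\<chi> (?\<psi> (Var i)) = (\<Sum>l<length fs. Const (\<Sum>j<length gs. a i j * b j l) * Var l)"
        by (simp only: subst_mat_Var subst_mat_linear)
      then have "Var i - ?\<chi> (?\<psi> (Var i)) = (\<Sum>l<length fs. Const (?c l) * Var l)"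
        by (simp only: Const.hom_diff left_diff_distrib sum_subtractf 0)
      moreover have "(\<Sum>l<length fs. ?c l * fs ! l) = 0"
      proof -
        have "(\<Sum>l<length fs. (\<Sum>j<length gs. a i j * b j l) * fs ! l)
            = (\<Sum>l<length fs. \<Sum>j<length gs. a i j * (b j l * fs ! l))"
          by (simp add: sum_distrib_right mult.assoc)
        also have "\<dots> = (\<Sum>j<length gs. a i j * (\<Sum>l<length fs. b j l * fs ! l))"
          by (subst sum.swap) (simp add: sum_distrib_left)
        also have "\<dots> = fs ! i" using a[OF i] b by simp
        finally have 1: "(\<Sum>l<length fs. (\<Sum>j<length gs. a i j * b j l) * fs ! l) = fs ! i" .
        have "(\<Sum>l<length fs. (if l = i then 1 else 0) * fs ! l) = (\<Sum>l<length fs. if l = i then fs ! l else 0)"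
          by (rule sum.cong) auto
        also have "\<dots> = fs ! i" using i by simp
        finally show ?thesis using 1 by (simp add: left_diff_distrib sum_subtractf)
      qed
      ultimately have "Var i - ?\<chi> (?\<psi> (Var i)) \<in> linear_relations fs"
        unfolding linear_relations_def by (intro CollectI exI[of _ ?c]) simp
      then show "Var i \<in> polys (length fs) \<and> Var i - ?\<chi> (?\<psi> (Var i)) \<in> sym_ideal fs"
        using polys_Var[OF i] gen_ideal_of_superset unfolding sym_ideal_def by blast
    next
      fix p q
      assume p: "p \<in> polys (length fs) \<and> p - ?\<chi> (?\<psi> p) \<in> sym_ideal fs"
        and q: "q \<in> polys (length fs) \<and> q - ?\<chi> (?\<psi> q) \<in> sym_ideal fs"
      have "p + q - ?\<chi> (?\<psi> (p + q)) = (p - ?\<chi> (?\<psi> p)) + (q - ?\<chi> (?\<psi> q))"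
        by (simp add: subst_mat.hom_add)
      then show "p + q \<in> polys (length fs) \<and> p + q - ?\<chi> (?\<psi> (p + q)) \<in> sym_ideal fs"
        using p q L polys_add by metis
      have "p * q - ?\<chi> (?\<psi> (p * q)) = q * (p - ?\<chi> (?\<psi> p)) + ?\<chi> (?\<psi> p) * (q - ?\<chi> (?\<psi> q))"
        by (simp add: subst_mat.hom_mult algebra_simps)
      moreover have "?\<chi> (?\<psi> p) \<in> polys (length fs)"
        using p subst_mat_polys by blast
      ultimately show "p * q \<in> polys (length fs) \<and> p * q - ?\<chi> (?\<psi> (p * q)) \<in> sym_ideal fs"
        using p q L polys_mult by metis
    qed
    then show ?thesis by blast
  qed
  show "r \<in> conductor_wrt fs"
    unfolding conductor_wrt_def
  proof (intro CollectI ballI)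
    fix P assume "P \<in> rees_ideal fs"
    then have P: "P \<in> polys (length fs)" "rees_map fs P = 0" by (auto simp: rees_ideal_def)
    have "?\<psi> P \<in> rees_ideal gs"
      using P subst_mat_polys[of P "length fs" a "length gs"] rees_map_subst_mat[OF a P(1)]
      by (auto simp: rees_ideal_def)
    then have "Const r * ?\<psi> P \<in> sym_ideal gs" using r by (auto simp: conductor_wrt_def)
    from subst_mat_sym_ideal[OF b this] have "Const r * ?\<chi> (?\<psi> P) \<in> sym_ideal fs"
      by (simp add: subst_mat.hom_mult)
    moreover have "Const r * (P - ?\<chi> (?\<psi> P)) \<in> sym_ideal fs"
      using retract[OF P(1)] L by simp
    moreover have "Const r * P = Const r * ?\<chi> (?\<psi> P) + Const r * (P - ?\<chi> (?\<psi> P))"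
      by (simp add: algebra_simps)
    ultimately show "Const r * P \<in> sym_ideal fs" using L by metis
  qed
qed

theorem conductor_eq:
  assumes "gen_ideal (set fs) = I"
  shows "conductor I = conductor_wrt fs"
proof -
  have "gen_ideal (set (SOME fs. gen_ideal (set fs) = I)) = I"
    using assms by (rule someI[of "\<lambda>fs. gen_ideal (set fs) = I"])
  then show ?thesis
    using assms conductor_wrt_mono unfolding conductor_def by (metis subset_antisym)
qed

end

theory Submission
  imports Defs
begin

text \<open>Let \<open>y\<close> be the variable of the additional generator \<open>f\<close>, and \<open>L'\<close>, \<open>J'\<close> the ideals of linear
  and of all relations of \<open>(I, f)\<close>. The hypothesis says that \<open>f\<close> is a nonzerodivisor on
  \<open>R[t]\<close> modulo the Rees algebra of \<open>I\<close>; together with \<open>f y\<^sub>i - f\<^sub>i y \<in> L'\<close> it allows one to lower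
  the degree in \<open>y\<close> and gives \<open>J' = J T[y] + L'\<close>, so \<open>C(I)\<close> multiplies \<open>J'\<close> into \<open>L'\<close>.
  On the other hand, \<open>(I, f)\<close> becomes the unit ideal after inverting \<open>f\<close>, so every element of
  \<open>J'\<close> is multiplied into \<open>L'\<close> by a power of \<open>f\<close>; one power suffices as \<open>J'\<close> is finitely
  generated by Hilbert's basis theorem.\<close>

section \<open>Hilbert's basis theorem for subrings\<close>

text \<open>The clause \<open>ideal_of T T\<close> expresses closure under sums and products;
  additive inverses come from \<open>- 1\<close>.\<close>

definition subring_of :: "'b::comm_ring_1 set \<Rightarrow> bool" where
  "subring_of T \<longleftrightarrow> ideal_of T T \<and> 1 \<in> T \<and> - 1 \<in> T"

definition noetherian_on :: "'b::comm_ring_1 set \<Rightarrow> bool" where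
  "noetherian_on T \<longleftrightarrow> (\<forall>A. ideal_of T A \<longrightarrow> (\<exists>S. finite S \<and> S \<subseteq> A \<and> gen_ideal_of T S = A))"

text \<open>The ring \<open>T[x]\<close> as the image of polynomials under evaluation. Since
  \<open>x\<close> may be algebraic over \<open>T\<close>, a representing polynomial need not be
  unique.\<close>

definition adjoin :: "'b::comm_ring_1 set \<Rightarrow> 'b \<Rightarrow> 'b set" where
  "adjoin T x = {poly p x | p. \<forall>i. coeff p i \<in> T}"

text \<open>Taking the coefficient at \<open>n\<close> of polynomials of degree at most
  \<open>n\<close>, instead of genuine leading coefficients, keeps 0 and all sums in the set. The
  polynomials range over the preimage of \<open>A\<close> under evaluation at
  \<open>x\<close>.\<close>

definition lead_coeffs :: "'b::comm_ring_1 set \<Rightarrow> 'b \<Rightarrow> 'b set \<Rightarrow> nat \<Rightarrow> 'b set" where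
  "lead_coeffs T x A n = {coeff p n | p. (\<forall>i. coeff p i \<in> T) \<and> degree p \<le> n \<and> poly p x \<in> A}"

lemma ideal_of_zero: "ideal_of T A \<Longrightarrow> 0 \<in> A"
  and ideal_of_add: "ideal_of T A \<Longrightarrow> a \<in> A \<Longrightarrow> b \<in> A \<Longrightarrow> a + b \<in> A"
  and ideal_of_mult: "ideal_of T A \<Longrightarrow> c \<in> T \<Longrightarrow> a \<in> A \<Longrightarrow> c * a \<in> A"
  and ideal_of_subset: "ideal_of T A \<Longrightarrow> A \<subseteq> T"
  by (auto simp: ideal_of_def)

lemma ideal_of_uminus: "subring_of T \<Longrightarrow> ideal_of T A \<Longrightarrow> a \<in> A \<Longrightarrow> - a \<in> A"
  using ideal_of_mult[of T A "- 1" a] by (simp add: subring_of_def)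

lemma ideal_of_diff: "subring_of T \<Longrightarrow> ideal_of T A \<Longrightarrow> a \<in> A \<Longrightarrow> b \<in> A \<Longrightarrow> a - b \<in> A"
  using ideal_of_add[of T A a "- b"] ideal_of_uminus[of T A b] by simp

context
  fixes T :: "'b::comm_ring_1 set" and x :: 'b
  assumes T: "subring_of T"
begin

lemma subring_ideal: "ideal_of T T"
  using T by (simp add: subring_of_def)

lemma adjoin_base: "c \<in> T \<Longrightarrow> c \<in> adjoin T x"
  unfolding adjoin_def
  by (intro CollectI exI[of _ "[:c:]"]) (auto simp: coeff_pCons ideal_of_zero[OF subring_ideal] split: nat.split)

lemma adjoin_var: "x \<in> adjoin T x"
  unfolding adjoin_def
  by (intro CollectI exI[of _ "[:0, 1:]"])
    (use T in \<open>auto simp: coeff_pCons ideal_of_zero[OF subring_ideal] subring_of_def split: nat.split\<close>)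

lemma adjoin_add: "a \<in> adjoin T x \<Longrightarrow> b \<in> adjoin T x \<Longrightarrow> a + b \<in> adjoin T x"
  unfolding adjoin_def by clarsimp (metis coeff_add ideal_of_add[OF subring_ideal] poly_add)

lemma adjoin_mult:
  assumes "a \<in> adjoin T x" "b \<in> adjoin T x"
  shows "a * b \<in> adjoin T x"
proof -
  obtain p q where pq: "a = poly p x" "b = poly q x" "\<And>i. coeff p i \<in> T" "\<And>i. coeff q i \<in> T"
    using assms by (auto simp: adjoin_def)
  then have "\<forall>i. coeff (p * q) i \<in> T"
    by (auto simp: coeff_mult intro!: ideal_of_sum[OF subring_ideal] ideal_of_mult[OF subring_ideal])
  then show ?thesis unfolding adjoin_def pq(1,2) poly_mult[symmetric] by blast
qed

lemma subring_of_adjoin: "subring_of (adjoin T x)"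
  using T adjoin_base adjoin_add adjoin_mult
  by (auto simp: subring_of_def ideal_of_def)

lemma ideal_lead_coeffs:
  assumes A: "ideal_of (adjoin T x) A"
  shows "ideal_of T (lead_coeffs T x A n)"
  unfolding ideal_of_def
proof (intro conjI ballI)
  show "lead_coeffs T x A n \<subseteq> T" by (auto simp: lead_coeffs_def)
  show "0 \<in> lead_coeffs T x A n"
    unfolding lead_coeffs_def
    by (intro CollectI exI[of _ 0]) (auto simp: ideal_of_zero[OF A] ideal_of_zero[OF subring_ideal])
next
  fix c d assume "c \<in> lead_coeffs T x A n" "d \<in> lead_coeffs T x A n"
  then obtain p q where
    "(\<forall>i. coeff p i \<in> T) \<and> degree p \<le> n \<and> poly p x \<in> A" "c = coeff p n"
    "(\<forall>i. coeff q i \<in> T) \<and> degree q \<le> n \<and> poly q x \<in> A" "d = coeff q n"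
    by (auto simp: lead_coeffs_def)
  then show "c + d \<in> lead_coeffs T x A n"
    unfolding lead_coeffs_def
    by (intro CollectI exI[of _ "p + q"])
      (auto intro: ideal_of_add[OF A] ideal_of_add[OF subring_ideal] degree_add_le)
next
  fix c d assume c: "c \<in> T" and "d \<in> lead_coeffs T x A n"
  then obtain q where
    "(\<forall>i. coeff q i \<in> T) \<and> degree q \<le> n \<and> poly q x \<in> A" "d = coeff q n"
    by (auto simp: lead_coeffs_def)
  then show "c * d \<in> lead_coeffs T x A n"
    unfolding lead_coeffs_def
    by (intro CollectI exI[of _ "smult c q"])
      (use c in \<open>auto intro: ideal_of_mult[OF A] adjoin_base ideal_of_mult[OF subring_ideal]
        order_trans[OF degree_smult_le]\<close>)
qed

text \<open>Multiplication by the variable raises the degree bound by one, keeps the top coefficient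
  and keeps the value in \<open>A\<close>.\<close>

lemma lead_coeffs_mono:
  assumes A: "ideal_of (adjoin T x) A" and "m \<le> n"
  shows "lead_coeffs T x A m \<subseteq> lead_coeffs T x A n"
proof (rule lift_Suc_mono_le[OF _ \<open>m \<le> n\<close>], rule subsetI)
  fix n c assume "c \<in> lead_coeffs T x A n"
  then obtain p where
    "(\<forall>i. coeff p i \<in> T) \<and> degree p \<le> n \<and> poly p x \<in> A" "c = coeff p n"
    by (auto simp: lead_coeffs_def)
  then show "c \<in> lead_coeffs T x A (Suc n)"
    unfolding lead_coeffs_def
    by (intro CollectI exI[of _ "pCons 0 p"])
      (auto simp: coeff_pCons ideal_of_zero[OF subring_ideal] degree_pCons_eq_if
        intro: ideal_of_mult[OF A] adjoin_var split: nat.split)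
qed

text \<open>A polynomial with value in \<open>A\<close> has its top coefficient cancelled by one
  with value in \<open>B\<close>; the difference still has its value in \<open>A\<close> and a
  smaller degree bound.\<close>

lemma subset_if_lead_coeffs_subset:
  assumes A: "ideal_of (adjoin T x) A" and B: "ideal_of (adjoin T x) B" and "B \<subseteq> A"
    and le: "\<And>n. lead_coeffs T x A n \<subseteq> lead_coeffs T x B n"
  shows "A \<subseteq> B"
proof -
  \<comment> \<open>The bound \<open>n\<close> is strict, so that the induction starts at the zero
    polynomial.\<close>
  have "poly p x \<in> B" if "\<forall>i. coeff p i \<in> T" "\<forall>i\<ge>n. coeff p i = 0" "poly p x \<in> A" for n p
    using that
  proof (induction n arbitrary: p)
    case 0
    then have "p = 0" by (simp add: poly_eq_iff)
    then show ?case by (simp add: ideal_of_zero[OF B])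
  next
    case (Suc n)
    then have "degree p \<le> n" by (intro degree_le) auto
    then have "coeff p n \<in> lead_coeffs T x A n"
      using Suc.prems by (auto simp: lead_coeffs_def)
    then obtain q where q: "\<forall>i. coeff q i \<in> T" "degree q \<le> n" "poly q x \<in> B" "coeff p n = coeff q n"
      using le[of n] unfolding lead_coeffs_def by blast
    have "poly (p - q) x \<in> B"
    proof (rule Suc.IH)
      show "\<forall>i. coeff (p - q) i \<in> T"
        using Suc.prems q by (auto intro: ideal_of_diff[OF T subring_ideal])
      show "\<forall>i\<ge>n. coeff (p - q) i = 0"
      proof (intro allI impI)
        fix i assume "n \<le> i"
        then show "coeff (p - q) i = 0"
          using Suc.prems(2) q(2,4) by (cases "i = n") (auto simp: coeff_eq_0)
      qed
      show "poly (p - q) x \<in> A"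
        using Suc.prems q \<open>B \<subseteq> A\<close> by (auto intro: ideal_of_diff[OF subring_of_adjoin A])
    qed
    from ideal_of_add[OF B this q(3)] show ?case by simp
  qed
  moreover have "\<forall>i\<ge>Suc (degree p). coeff p i = 0" for p :: "'b poly"
    by (auto intro: coeff_eq_0)
  ultimately show ?thesis
    using ideal_of_subset[OF A] by (fastforce simp: adjoin_def)
qed

text \<open>Hilbert's argument: the ideals of leading coefficients become constant from some degree
  \<open>N\<close> on, and finitely many elements of \<open>A\<close> realising generators of these
  ideals in degrees up to \<open>N\<close> generate \<open>A\<close>.\<close>

lemma noetherian_on_adjoin:
  assumes noeth: "noetherian_on T"
  shows "noetherian_on (adjoin T x)"
  unfolding noetherian_on_def
proof (intro allI impI)
  fix A assume A: "ideal_of (adjoin T x) A"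
  let ?l = "lead_coeffs T x"
  have "\<forall>n. \<exists>S. finite S \<and> S \<subseteq> ?l A n \<and> gen_ideal_of T S = ?l A n"
    using noeth ideal_lead_coeffs[OF A] by (auto simp: noetherian_on_def)
  then obtain S where S: "\<And>n. finite (S n)" "\<And>n. S n \<subseteq> ?l A n" "\<And>n. gen_ideal_of T (S n) = ?l A n"
    by metis
  \<comment> \<open>Finite generation of the union replaces the ascending chain condition: all its
    generators lie in one member of the chain.\<close>
  have "ideal_of T (\<Union>n. ?l A n)"
    unfolding ideal_of_def
  proof (intro conjI ballI)
    fix c d assume "c \<in> (\<Union>n. ?l A n)" "d \<in> (\<Union>n. ?l A n)"
    then obtain m n where "c \<in> ?l A m" "d \<in> ?l A n" by blast
    then have "c \<in> ?l A (max m n)" "d \<in> ?l A (max m n)"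
      using lead_coeffs_mono[OF A] by (meson max.cobounded1 max.cobounded2 subsetD)+
    then show "c + d \<in> (\<Union>n. ?l A n)"
      using ideal_of_add[OF ideal_lead_coeffs[OF A]] by blast
  next
    show "(\<Union>n. ?l A n) \<subseteq> T"
      using ideal_of_subset[OF ideal_lead_coeffs[OF A]] by blast
    show "0 \<in> (\<Union>n. ?l A n)"
      using ideal_of_zero[OF ideal_lead_coeffs[OF A]] by blast
  next
    fix c d assume "c \<in> T" "d \<in> (\<Union>n. ?l A n)"
    then show "c * d \<in> (\<Union>n. ?l A n)"
      using ideal_of_mult[OF ideal_lead_coeffs[OF A]] by blast
  qed
  from noeth[unfolded noetherian_on_def, rule_format, OF this] obtain U where U: "finite U" "U \<subseteq> (\<Union>n. ?l A n)" "gen_ideal_of T U = (\<Union>n. ?l A n)" by blast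
  have "\<exists>N. U \<subseteq> ?l A N"
    using U(1,2)
  proof (induction U rule: finite_induct)
    case (insert c U)
    then obtain N n where "U \<subseteq> ?l A N" "c \<in> ?l A n" by blast
    then have "insert c U \<subseteq> ?l A (max N n)"
      using lead_coeffs_mono[OF A, of N "max N n"] lead_coeffs_mono[OF A, of n "max N n"] by auto
    then show ?case by blast
  qed simp
  then obtain N where "U \<subseteq> ?l A N" by blast
  then have stable: "?l A n \<subseteq> ?l A N" for n
    using gen_ideal_of_minimal[OF _ ideal_lead_coeffs[OF A]] U(3) by blast
  have "\<forall>n. \<forall>c\<in>S n. \<exists>p. (\<forall>i. coeff p i \<in> T) \<and> degree p \<le> n \<and> poly p x \<in> A \<and> coeff p n = c"
    using S(2) by (fastforce simp: lead_coeffs_def)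
  then obtain w where w: "\<And>n c. c \<in> S n \<Longrightarrow>
      (\<forall>i. coeff (w n c) i \<in> T) \<and> degree (w n c) \<le> n \<and> poly (w n c) x \<in> A \<and> coeff (w n c) n = c"
    by metis
  define G where "G = (\<Union>n\<le>N. (\<lambda>c. poly (w n c) x) ` S n)"
  define B where "B = gen_ideal_of (adjoin T x) G"
  have G: "finite G" "G \<subseteq> A"
    using S(1) w by (auto simp: G_def)
  have B: "ideal_of (adjoin T x) B"
    unfolding B_def
    using G(2) ideal_of_subset[OF A] subring_of_adjoin
    by (intro ideal_of_gen_ideal_of) (auto simp: subring_of_def)
  have "B \<subseteq> A" unfolding B_def by (rule gen_ideal_of_minimal[OF G(2) A])
  have low: "?l A n \<subseteq> ?l B n" if "n \<le> N" for n
    unfolding S(3)[of n, symmetric]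
  proof (rule gen_ideal_of_minimal[OF _ ideal_lead_coeffs[OF B]], rule subsetI)
    fix c assume c: "c \<in> S n"
    then have "poly (w n c) x \<in> B"
      using that gen_ideal_of_superset[of G] by (auto simp: B_def G_def)
    then show "c \<in> ?l B n"
      using w[OF c] unfolding lead_coeffs_def by (intro CollectI exI[of _ "w n c"]) simp
  qed
  \<comment> \<open>Beyond \<open>N\<close>, the inclusion is a detour through degree
    \<open>N\<close>: stability for \<open>A\<close>, the case \<open>N\<close> itself, then
    monotonicity for \<open>B\<close>.\<close>
  have "?l A n \<subseteq> ?l B n" for n
    using low[of n] low[of N] stable[of n] lead_coeffs_mono[OF B, of N n]
    by (cases "n \<le> N") auto
  from subset_if_lead_coeffs_subset[OF A B \<open>B \<subseteq> A\<close> this] \<open>B \<subseteq> A\<close> G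
  show "\<exists>S. finite S \<and> S \<subseteq> A \<and> gen_ideal_of (adjoin T x) S = A"
    unfolding B_def by blast
qed

end

section \<open>The basis theorem for \<open>polys m\<close>, adjoining one variable at a
  time\<close>

lemma subring_of_polys: "subring_of (polys m :: 'a::comm_ring_1 mpoly set)"
  using ideal_of_polys[where ?'a = 'a] polys_Const[of "1::'a" m] polys_Const[of "- 1::'a" m]
  by (simp add: subring_of_def Const_def single_uminus)

lemma polys_0: "polys 0 = range Const"
proof
  show "polys 0 \<subseteq> (range Const :: 'a::comm_ring_1 mpoly set)"
  proof
    fix P :: "'a mpoly" assume "P \<in> polys 0"
    then show "P \<in> range Const"
      by (rule mpoly_closure) (auto simp flip: Const_add Const_mult)
  qed
qed auto

lemma polys_mono: "m \<le> n \<Longrightarrow> polys m \<subseteq> polys n"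
  by (force simp: polys_def)

lemma polys_power: "P \<in> polys m \<Longrightarrow> P ^ k \<in> polys m"
  using polys_Const[of 1 m] by (induction k) (auto simp: Const_def intro: polys_mult)

lemma polys_poly:
  assumes "\<And>i. coeff p i \<in> polys m" "x \<in> polys m"
  shows "poly p x \<in> polys m"
  unfolding poly_altdef by (intro polys_sum polys_mult assms polys_power)

lemma polys_Suc: "polys (Suc m) = adjoin (polys m) (Var m :: 'a::comm_ring_1 mpoly)"
proof
  note S = subring_of_polys[of m]
  show "polys (Suc m) \<subseteq> adjoin (polys m) (Var m :: 'a mpoly)"
  proof
    fix P :: "'a mpoly" assume "P \<in> polys (Suc m)"
    then show "P \<in> adjoin (polys m) (Var m)"
    proof (rule mpoly_closure)
      fix i assume "i < Suc m"
      then show "Var i \<in> adjoin (polys m) (Var m :: 'a mpoly)"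
        using adjoin_var[OF S, of "Var m"] adjoin_base[OF S polys_Var] by (auto simp: less_Suc_eq)
    qed (auto intro: adjoin_add[OF S] adjoin_mult[OF S] adjoin_base[OF S])
  qed
  show "adjoin (polys m) (Var m :: 'a mpoly) \<subseteq> polys (Suc m)"
    using polys_mono[of m "Suc m"] by (fastforce simp: adjoin_def intro!: polys_poly polys_Var)
qed

lemma noetherian_on_polys:
  assumes "noetherian TYPE('a::comm_ring_1)"
  shows "noetherian_on (polys m :: 'a mpoly set)"
proof (induction m)
  case 0
  show ?case
    unfolding noetherian_on_def
  proof (intro allI impI)
    fix A :: "'a mpoly set" assume A: "ideal_of (polys 0) A"
    \<comment> \<open>\<open>polys 0\<close> is a copy of \<open>R\<close>, so the ideal is pulled
      back along \<open>Const\<close> to use the hypothesis on the type.\<close>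
    have "is_ideal {c. Const c \<in> A}"
      using A by (auto simp: ideal_of_def Const_add Const_mult Const.hom_zero)
    then obtain S where S: "finite S" "gen_ideal S = {c. Const c \<in> A}"
      using assms by (auto simp: noetherian_def)
    have SA: "Const ` S \<subseteq> A" using gen_ideal_of_superset[of S UNIV] S by auto
    let ?B = "gen_ideal_of (polys 0) (Const ` S)"
    have B: "ideal_of (polys 0) ?B"
      by (intro ideal_of_gen_ideal_of ideal_of_polys) auto
    have "A \<subseteq> ?B"
    proof
      fix P assume P: "P \<in> A"
      then obtain c where c: "P = Const c" using ideal_of_subset[OF A] by (auto simp: polys_0)
      have "is_ideal {c. Const c \<in> ?B}"
        using B by (auto simp: ideal_of_def Const_add Const_mult Const.hom_zero)
      moreover have "S \<subseteq> {c. Const c \<in> ?B}"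
        using gen_ideal_of_superset[of "Const ` S" "polys 0"] by auto
      ultimately have "gen_ideal S \<subseteq> {c. Const c \<in> ?B}" by (intro gen_ideal_of_minimal)
      then show "P \<in> ?B" using P S(2) c by auto
    qed
    then have "?B = A" using gen_ideal_of_minimal[OF SA A] by blast
    then show "\<exists>S. finite S \<and> S \<subseteq> A \<and> gen_ideal_of (polys 0) S = A"
      using S(1) SA by blast
  qed
next
  case (Suc m)
  then show ?case unfolding polys_Suc by (rule noetherian_on_adjoin[OF subring_of_polys])
qed

section \<open>The image of the Rees map\<close>

lemma is_ideal_gen_ideal: "is_ideal (gen_ideal S)"
  by (rule ideal_of_gen_ideal_of) auto

lemma is_ideal_pow: "is_ideal (ideal_pow I j)"
  by (cases j) (auto simp: ideal_mult_def is_ideal_gen_ideal)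

lemma mult_in_ideal_pow_Suc:
  assumes "x \<in> I" "y \<in> ideal_pow I j"
  shows "x * y \<in> ideal_pow I (Suc j)"
proof -
  have "x * y \<in> {x * y | x y. x \<in> I \<and> y \<in> ideal_pow I j}" using assms by blast
  then show ?thesis
    unfolding ideal_pow.simps ideal_mult_def by (rule subsetD[OF gen_ideal_of_superset])
qed

lemma ideal_pow_Suc_subset:
  assumes "is_ideal A" and "\<And>x y. x \<in> I \<Longrightarrow> y \<in> ideal_pow I j \<Longrightarrow> x * y \<in> A"
  shows "ideal_pow I (Suc j) \<subseteq> A"
  unfolding ideal_pow.simps ideal_mult_def by (rule gen_ideal_of_minimal) (use assms in auto)

lemma ideal_pow_mult:
  assumes "a \<in> ideal_pow I i" "b \<in> ideal_pow I j"
  shows "a * b \<in> ideal_pow I (i + j)"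
  using assms(1)
proof (induction i arbitrary: a)
  case 0
  then show ?case using ideal_of_mult[OF is_ideal_pow] assms(2) by simp
next
  case (Suc i)
  \<comment> \<open>With \<open>b\<close> fixed this set is an ideal, so only the generating
    products of \<open>ideal_pow I (Suc i)\<close> have to be tested.\<close>
  let ?A = "{a. a * b \<in> ideal_pow I (Suc i + j)}"
  have "is_ideal ?A"
    using is_ideal_pow[of I "Suc i + j"] by (auto simp: ideal_of_def distrib_right mult.assoc simp del: ideal_pow.simps)
  then have "ideal_pow I (Suc i) \<subseteq> ?A"
  proof (rule ideal_pow_Suc_subset)
    fix x y assume "x \<in> I" "y \<in> ideal_pow I i"
    then show "x * y \<in> ?A"
      using mult_in_ideal_pow_Suc[OF _ Suc.IH[of y]] by (simp add: mult.assoc del: ideal_pow.simps)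
  qed
  then show ?case using Suc.prems by blast
qed

text \<open>With its converse \<open>in_rees_map_image\<close>, this describes the Rees algebra
  coefficientwise by the powers of \<open>I\<close>, the form in which the colon hypothesis can be
  applied.\<close>

lemma coeff_rees_map_mem:
  assumes "P \<in> polys (length fs)" and gen: "gen_ideal (set fs) = I"
  shows "coeff (rees_map fs P) j \<in> ideal_pow I j"
proof -
  have "\<forall>j. coeff (rees_map fs P) j \<in> ideal_pow I j"
    using assms(1)
  proof (rule mpoly_closure)
    fix c show "\<forall>j. coeff (rees_map fs (Const c)) j \<in> ideal_pow I j"
      using ideal_of_zero[OF is_ideal_pow]
      by (auto simp: rees_map_Const coeff_pCons simp del: ideal_pow.simps split: nat.split) simp
  next
    fix i assume "i < length fs"
    then have "fs ! i \<in> I"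
      using gen gen_ideal_of_superset[of "set fs" UNIV] by auto
    then have "fs ! i \<in> ideal_pow I 1"
      using mult_in_ideal_pow_Suc[of "fs ! i" I 1 0] by simp
    then show "\<forall>j. coeff (rees_map fs (Var i)) j \<in> ideal_pow I j"
      using ideal_of_zero[OF is_ideal_pow] by (auto simp: rees_map_Var coeff_monom simp del: ideal_pow.simps)
  next
    fix p q assume *: "\<forall>j. coeff (rees_map fs p) j \<in> ideal_pow I j"
      "\<forall>j. coeff (rees_map fs q) j \<in> ideal_pow I j"
    then show "\<forall>j. coeff (rees_map fs (p + q)) j \<in> ideal_pow I j"
      by (auto simp: rees_map.hom_add intro: ideal_of_add[OF is_ideal_pow])
    show "\<forall>j. coeff (rees_map fs (p * q)) j \<in> ideal_pow I j"
    proof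
      fix j
      have "coeff (rees_map fs p) i * coeff (rees_map fs q) (j - i) \<in> ideal_pow I j" if "i \<le> j" for i
        using ideal_pow_mult[OF *(1)[rule_format] *(2)[rule_format], of i "j - i"] that by simp
      then show "coeff (rees_map fs (p * q)) j \<in> ideal_pow I j"
        by (auto simp: rees_map.hom_mult coeff_mult intro!: ideal_of_sum[OF is_ideal_pow])
    qed
  qed
  then show ?thesis by blast
qed

text \<open>In the step, the admissible coefficients form an ideal, so products \<open>x * y\<close>
  suffice: the factor \<open>x\<close> in \<open>I\<close> is realised in degree one by a linear
  form, and \<open>y\<close> by induction.\<close>

lemma monom_in_rees_map_image:
  assumes gen: "gen_ideal (set fs) = I" and "c \<in> ideal_pow I j"
  shows "monom c j \<in> rees_map fs ` polys (length fs)"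
  using assms(2)
proof (induction j arbitrary: c)
  case 0
  have "rees_map fs (Const c) = monom c 0" by (simp add: rees_map_Const monom_0)
  then show ?case by (metis imageI polys_Const)
next
  case (Suc j)
  let ?R = "rees_map fs ` polys (length fs)"
  let ?A = "{c. monom c (Suc j) \<in> ?R}"
  have "is_ideal ?A"
    unfolding ideal_of_def
  proof (intro conjI ballI)
    show "0 \<in> ?A" using rees_map.hom_zero[of fs] by (auto intro!: image_eqI[of _ _ 0])
  next
    fix c d assume "c \<in> ?A" "d \<in> ?A"
    then obtain P Q where "P \<in> polys (length fs)" "rees_map fs P = monom c (Suc j)"
      "Q \<in> polys (length fs)" "rees_map fs Q = monom d (Suc j)" by auto
    then show "c + d \<in> ?A"
      by (auto simp: rees_map.hom_add add_monom polys_add intro!: image_eqI[of _ _ "P + Q"])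
  next
    fix c d assume "d \<in> ?A"
    then obtain Q where "Q \<in> polys (length fs)" "rees_map fs Q = monom d (Suc j)" by auto
    then show "c * d \<in> ?A"
      by (auto simp: rees_map.hom_mult rees_map_Const smult_monom polys_mult
          intro!: image_eqI[of _ _ "Const c * Q"])
  qed auto
  then have "ideal_pow I (Suc j) \<subseteq> ?A"
  proof (rule ideal_pow_Suc_subset)
    fix x y assume xy: "x \<in> I" "y \<in> ideal_pow I j"
    then obtain Q where Q: "Q \<in> polys (length fs)" "rees_map fs Q = monom y j"
      using Suc.IH by fastforce
    obtain a where a: "x = (\<Sum>i<length fs. a i * fs ! i)"
      using xy(1) mem_gen_ideal_list[of x fs] gen by blast
    let ?P = "\<Sum>i<length fs. Const (a i) * Var i"
    have "rees_map fs (?P * Q) = monom (x * y) (Suc j)"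
      by (simp add: rees_map.hom_mult rees_map_linear Q a mult_monom)
    moreover have "?P * Q \<in> polys (length fs)"
      using Q by (auto intro!: polys_mult polys_sum polys_Var)
    ultimately show "x * y \<in> ?A" 
      unfolding mem_Collect_eq by (rule image_eqI[OF sym])
  qed
  then show ?case using Suc.prems by blast
qed

lemma in_rees_map_image:
  assumes "gen_ideal (set fs) = I" and "\<And>j. coeff s j \<in> ideal_pow I j"
  shows "s \<in> rees_map fs ` polys (length fs)"
proof -
  have "\<exists>P\<in>polys (length fs). rees_map fs P = monom (coeff s j) j" for j
    using monom_in_rees_map_image[OF assms(1) assms(2)[of j]] by (metis imageE)
  then obtain P where P: "\<And>j. P j \<in> polys (length fs)" "\<And>j. rees_map fs (P j) = monom (coeff s j) j"
    by metis
  have "rees_map fs (\<Sum>j\<le>degree s. P j) = s"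
    by (simp add: rees_map.hom_sum P poly_as_sum_of_monoms)
  moreover have "(\<Sum>j\<le>degree s. P j) \<in> polys (length fs)"
    by (intro polys_sum P)
  ultimately show ?thesis by (metis imageI)
qed

text \<open>Every monomial except the constant one is divisible by a variable. The decomposition
  later turns a factor \<open>y\<^sub>i\<close> into \<open>f\<^sub>i\<close> by the exchange
  relations.\<close>

lemma polys_split:
  assumes "P \<in> polys n"
  shows "\<exists>c F. (\<forall>i. F i \<in> polys n) \<and> P = Const c + (\<Sum>i<n. Var i * F i)"
proof -
  have "P \<in> polys n \<and> (\<exists>c F. (\<forall>i. F i \<in> polys n) \<and> P = Const c + (\<Sum>i<n. Var i * F i))"
    using assms
  proof (rule mpoly_closure)
    fix c :: 'a
    show "Const c \<in> polys n \<and> (\<exists>d F. (\<forall>i. F i \<in> polys n) \<and> Const c = Const d + (\<Sum>i<n. Var i * F i))"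
      by (auto intro!: exI[of _ c] exI[of _ "\<lambda>_. 0"])
  next
    fix i assume i: "i < n"
    have "(\<Sum>j<n. Var j * (if j = i then 1 else 0 :: 'a mpoly)) = (\<Sum>j<n. if j = i then Var i else 0)"
      by (rule sum.cong) auto
    also have "\<dots> = Var i" using i by simp
    finally show "Var i \<in> polys n \<and> (\<exists>c F. (\<forall>i. F i \<in> polys n) \<and> Var i = Const c + (\<Sum>j<n. Var j * F j :: 'a mpoly))"
      \<comment> \<open>This instance says that \<open>0 ^ 0\<close>, which is 1, lies in
        \<open>polys n\<close>.\<close>
      using i polys_power[of "0::'a mpoly" n 0]
      by (intro conjI polys_Var exI[of _ 0] exI[of _ "\<lambda>j. if j = i then 1 else 0"]) (auto simp: Const.hom_zero)
  next
    fix p q :: "'a mpoly"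
    assume "p \<in> polys n \<and> (\<exists>c F. (\<forall>i. F i \<in> polys n) \<and> p = Const c + (\<Sum>i<n. Var i * F i))"
      "q \<in> polys n \<and> (\<exists>c F. (\<forall>i. F i \<in> polys n) \<and> q = Const c + (\<Sum>i<n. Var i * F i))"
    then obtain c F d G where
      p: "p \<in> polys n" "\<And>i. F i \<in> polys n" "p = Const c + (\<Sum>i<n. Var i * F i)" and
      q: "q \<in> polys n" "\<And>i. G i \<in> polys n" "q = Const d + (\<Sum>i<n. Var i * G i)" by blast
    have "p + q = Const (c + d) + (\<Sum>i<n. Var i * (F i + G i))"
      by (simp add: p(3) q(3) Const_add distrib_left sum.distrib)
    then show "p + q \<in> polys n \<and> (\<exists>c F. (\<forall>i. F i \<in> polys n) \<and> p + q = Const c + (\<Sum>i<n. Var i * F i))"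
      using polys_add[OF p(1) q(1)] polys_add[OF p(2) q(2)]
      by (intro conjI exI[of _ "c + d"] exI[of _ "\<lambda>i. F i + G i"]) auto
    \<comment> \<open>The part of \<open>p\<close> divisible by variables absorbs all of
      \<open>q\<close>; only its constant term requires the splitting of \<open>q\<close>.\<close>
    have "(\<Sum>i<n. Var i * (F i * q + Const c * G i)) = (\<Sum>i<n. Var i * F i) * q + Const c * (\<Sum>i<n. Var i * G i)"
      by (simp add: distrib_left sum.distrib sum_distrib_left sum_distrib_right mult_ac)
    also have "\<dots> = (p - Const c) * q + Const c * (q - Const d)"
      by (simp add: p(3) q(3))
    finally have "p * q = Const (c * d) + (\<Sum>i<n. Var i * (F i * q + Const c * G i))"
      by (simp add: Const_mult algebra_simps)
    moreover have "\<forall>i. F i * q + Const c * G i \<in> polys n"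
      using p q by (intro allI polys_add polys_mult polys_Const)
    ultimately show "p * q \<in> polys n \<and> (\<exists>c F. (\<forall>i. F i \<in> polys n) \<and> p * q = Const c + (\<Sum>i<n. Var i * F i))"
      using polys_mult[OF p(1) q(1)]
      by (intro conjI exI[of _ "c * d"] exI[of _ "\<lambda>i. F i * q + Const c * G i"]) auto
  qed
  then show ?thesis by blast
qed

section \<open>Adding a generator\<close>

text \<open>The new generator is put last, so the variables below \<open>n\<close> keep their
  meaning and \<open>Var n\<close> is the variable belonging to \<open>f\<close>.\<close>

context
  fixes fs gs :: "'a::comm_ring_1 list" and f :: 'a and n :: nat
  defines "n \<equiv> length fs" and "gs \<equiv> fs @ [f]"
begin

lemma length_gs: "length gs = Suc n"
  by (simp add: gs_def n_def)

lemma nth_gs: "i < n \<Longrightarrow> gs ! i = fs ! i" "gs ! n = f"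
  by (simp_all add: gs_def n_def nth_append)

lemma ideal_sym: "ideal_of (polys (Suc n)) (sym_ideal gs)"
  using ideal_of_sym_ideal[of gs] by (simp add: length_gs)

lemmas sym_add = ideal_of_add[OF ideal_sym]
  and sym_mult = ideal_of_mult[OF ideal_sym]

lemma polys_Suc_mem: "P \<in> polys n \<Longrightarrow> P \<in> polys (Suc n)"
  using polys_mono[of n "Suc n"] by auto

lemma linear_relation_sym:
  assumes "(\<Sum>i\<le>n. a i * gs ! i) = 0"
  shows "(\<Sum>i\<le>n. Const (a i) * Var i) \<in> sym_ideal gs"
proof -
  have "(\<Sum>i\<le>n. Const (a i) * Var i) \<in> linear_relations gs"
    using assms unfolding linear_relations_def length_gs lessThan_Suc_atMost by blast
  then show ?thesis unfolding sym_ideal_def by (rule subsetD[OF gen_ideal_of_superset])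
qed

lemma rees_map_gs:
  assumes "P \<in> polys n" shows "rees_map gs P = rees_map fs P"
  using assms
  by (rule mpoly_closure)
    (auto simp: rees_map_Const rees_map_Var rees_map.hom_add rees_map.hom_mult nth_gs)

lemma sym_ideal_subset: "sym_ideal fs \<subseteq> sym_ideal gs"
proof -
  \<comment> \<open>The hull defining \<open>sym_ideal fs\<close> is taken in
    \<open>polys n\<close>, hence the intersection, which is an ideal of that smaller ring.
    Relations are padded with coefficient 0 at \<open>f\<close>.\<close>
  have "linear_relations fs \<subseteq> polys n \<inter> sym_ideal gs"
  proof
    fix P assume P: "P \<in> linear_relations fs"
    then obtain a where a: "P = (\<Sum>i<n. Const (a i) * Var i)" "(\<Sum>i<n. a i * fs ! i) = 0"
      by (auto simp: linear_relations_def n_def)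
    have "(\<Sum>i\<le>n. Const ((a(n := 0)) i) * Var i) \<in> sym_ideal gs"
      by (rule linear_relation_sym) (simp add: nth_gs a flip: lessThan_Suc_atMost)
    then show "P \<in> polys n \<inter> sym_ideal gs"
      using linear_relations_subset[of fs] P
      by (auto simp: a Const.hom_zero n_def simp flip: lessThan_Suc_atMost)
  qed
  moreover have "ideal_of (polys n) (polys n \<inter> sym_ideal gs)"
    unfolding ideal_of_def
    by (auto intro: polys_add polys_mult sym_add sym_mult polys_Suc_mem ideal_of_zero[OF ideal_sym])
  ultimately have "sym_ideal fs \<subseteq> polys n \<inter> sym_ideal gs"
    unfolding sym_ideal_def[of fs] n_def by (rule gen_ideal_of_minimal)
  then show ?thesis by blast
qed

text \<open>This comes from the trivial (Koszul) relation between \<open>f\<close> and another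
  generator.\<close>

lemma exchange_sym:
  assumes "i \<le> n"
  shows "Const f * Var i - Const (gs ! i) * Var n \<in> sym_ideal gs"
proof (cases "i = n")
  case True
  then show ?thesis using ideal_of_zero[OF ideal_sym] by (simp add: nth_gs)
next
  case False
  then have i: "i < n" using assms by simp
  let ?a = "(\<lambda>_. 0)(i := f, n := - (gs ! i))"
  have rest: "(\<Sum>j<n. g (?a j) j) = g f i" if "\<And>j. g 0 j = 0" for g :: "'a \<Rightarrow> nat \<Rightarrow> 'b::comm_monoid_add"
  proof -
    have "(\<Sum>j<n. g (?a j) j) = (\<Sum>j<n. if j = i then g f i else 0)"
      by (rule sum.cong) (auto simp: that)
    then show ?thesis using i by simp
  qed
  \<comment> \<open>The summand is kept general because the evaluation is applied both to elements
    of \<open>R\<close> and to linear forms.\<close>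
  have eq: "(\<Sum>j\<le>n. g (?a j) j) = g f i + g (- (gs ! i)) n" if "\<And>j. g 0 j = 0"
    for g :: "'a \<Rightarrow> nat \<Rightarrow> 'b::comm_monoid_add"
    using rest[of g, OF that] unfolding lessThan_Suc_atMost[symmetric] sum.lessThan_Suc by simp
  have "(\<Sum>j\<le>n. ?a j * gs ! j) = 0"
    using eq[of "\<lambda>c j. c * gs ! j"] by (simp add: nth_gs)
  from linear_relation_sym[OF this] have "Const f * Var i + Const (- (gs ! i)) * Var n \<in> sym_ideal gs"
    by (simp only: eq[of "\<lambda>c j. Const c * Var j"] Const.hom_zero mult_zero_left)
  then show ?thesis
    using Const.hom_diff[of 0 "gs ! i"] by (simp add: Const.hom_zero)
qed


lemma sym_ideal_subset_rees_ideal: "sym_ideal gs \<subseteq> rees_ideal gs"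
  unfolding sym_ideal_def
proof (rule gen_ideal_of_minimal)
  show "linear_relations gs \<subseteq> rees_ideal gs"
    using linear_relations_subset[of gs]
    by (auto simp: rees_ideal_def) (auto simp: linear_relations_def rees_map_linear)
  show "ideal_of (polys (length gs)) (rees_ideal gs)"
    by (auto simp: ideal_of_def rees_ideal_def polys_add polys_mult rees_map.hom_zero
        rees_map.hom_add rees_map.hom_mult)
qed

text \<open>Here the hypothesis on \<open>I\<^sup>j : f\<close> enters: if \<open>P + y Q\<close> is a relation, then \<open>t Q\<close>, evaluated at the
  generators, is an element of \<open>R[t]\<close> whose product with \<open>f\<close> lies in the Rees algebra of \<open>I\<close>,
  hence is itself the value of a polynomial \<open>G = \<Sum>\<^sub>i y\<^sub>i G\<^sub>i\<close>. Modulo the linear relations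
  \<open>f y\<^sub>i - f\<^sub>i y\<close>, the relation becomes \<open>(P + f G) + y (Q - \<Sum>\<^sub>i f\<^sub>i G\<^sub>i)\<close>, a sum of a relation
  of \<open>I\<close> and a multiple of a relation of smaller degree in \<open>y\<close>.\<close>

lemma conductor_wrt_mult_mem:
  assumes gen: "gen_ideal (set fs) = I"
    and colon: "\<And>j. colon (ideal_pow I j) f = ideal_pow I j"
    and r: "r \<in> conductor_wrt fs"
    and "\<forall>i. coeff p i \<in> polys n" "rees_map gs (poly p (Var n)) = 0"
  shows "Const r * poly p (Var n) \<in> sym_ideal gs"
  using assms(4,5)
proof (induction "degree p" arbitrary: p rule: less_induct)
  case less
  obtain P q where p: "p = pCons P q" by (cases p)
  have P: "P \<in> polys n" using less.prems(1)[rule_format, of 0] by (simp add: p)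
  have q: "coeff q i \<in> polys n" for i using less.prems(1)[rule_format, of "Suc i"] by (simp add: p)
  define y where "y = (Var n :: 'a mpoly)"
  define Q where "Q = poly q y"
  have y: "y \<in> polys (Suc n)" by (simp add: y_def polys_Var)
  have py: "poly p (Var n) = P + y * Q" by (simp add: p Q_def y_def)
  have J: "Const r * F \<in> sym_ideal gs" if "F \<in> polys n" "rees_map fs F = 0" for F
  proof -
    have "Const r * F \<in> sym_ideal fs"
      using r that by (auto simp: conductor_wrt_def rees_ideal_def n_def)
    then show ?thesis using sym_ideal_subset by blast
  qed
  show ?case
  proof (cases "q = 0")
    case True
    then have "poly p (Var n) = P" by (simp add: p)
    then show ?thesis using J[OF P] less.prems(2) rees_map_gs[OF P] by simp
  next
    case False
    define s where "s = monom 1 1 * rees_map gs Q"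
    have ry: "rees_map gs y = smult f (monom 1 1)"
      by (simp add: y_def rees_map_Var nth_gs smult_monom)
    have 0: "rees_map fs P + smult f s = 0"
      using less.prems(2) by (simp add: py s_def rees_map.hom_add rees_map.hom_mult ry rees_map_gs[OF P])
    have "coeff s j \<in> ideal_pow I j" for j
    proof -
      have "coeff s j * f = - 1 * coeff (rees_map fs P) j"
        using arg_cong[OF 0, of "\<lambda>u. coeff u j"] by (simp add: mult.commute eq_neg_iff_add_eq_0 add.commute)
      moreover have "- 1 * coeff (rees_map fs P) j \<in> ideal_pow I j"
        using coeff_rees_map_mem[OF P[unfolded n_def] gen] by (intro ideal_of_mult[OF is_ideal_pow]) auto
      ultimately have "coeff s j \<in> colon (ideal_pow I j) f" by (simp add: colon_def)
      then show ?thesis using colon by simp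
    qed
    from in_rees_map_image[OF gen this] obtain G where G: "G \<in> polys n" "rees_map fs G = s"
      by (auto simp: n_def)
    obtain c F where F: "\<And>i. F i \<in> polys n" and GF: "G = Const c + (\<Sum>i<n. Var i * F i)"
      using polys_split[OF G(1)] by blast
    \<comment> \<open>The element \<open>s\<close> is a multiple of \<open>t\<close>, so comparing
      coefficients in degree 0 removes the constant term of \<open>G\<close>.\<close>
    have "coeff (rees_map fs G) 0 = c"
      by (simp add: GF rees_map.hom_add rees_map.hom_sum rees_map.hom_mult rees_map_Const rees_map_Var
          coeff_sum coeff_mult_0)
    then have "c = 0" by (simp add: G s_def coeff_mult_0)
    then have GF: "G = (\<Sum>i<n. Var i * F i)" using GF by (simp add: Const.hom_zero)
    define K where "K = (\<Sum>i<n. Const (fs ! i) * F i)"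
    have K: "K \<in> polys n" unfolding K_def by (intro polys_sum polys_mult F polys_Const)
    have "monom 1 1 * rees_map gs K = rees_map fs G"
      unfolding rees_map_gs[OF K] unfolding K_def GF
      by (simp add: rees_map.hom_sum rees_map.hom_mult rees_map_Const rees_map_Var sum_distrib_left
          smult_monom flip: mult_smult_left)
    then have "monom 1 1 * rees_map gs (Q - K) = 0"
      by (simp add: rees_map.hom_diff right_diff_distrib G s_def)
    \<comment> \<open>Multiplication by \<open>t\<close> only shifts coefficients, so
      \<open>t\<close> cancels even if \<open>R\<close> has zero divisors.\<close>
    then have H0: "rees_map gs (Q - K) = 0"
      by (simp add: monom_altdef)
    have QK: "poly (q - [:K:]) (Var n) = Q - K" by (simp add: Q_def y_def)
    \<comment> \<open>\<open>K\<close> does not involve the variable of \<open>f\<close>, so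
      subtracting it keeps the degree bound; as \<open>q\<close> is nonzero, this is below the
      degree of \<open>p\<close>.\<close>
    have "degree (q - [:K:]) \<le> degree q" by (rule degree_diff_le) auto
    then have deg: "degree (q - [:K:]) < degree p" using False by (simp add: p)
    have "\<forall>i. coeff (q - [:K:]) i \<in> polys n"
      using q K ideal_of_diff[OF subring_of_polys ideal_of_polys]
      by (auto simp: coeff_pCons split: nat.split)
    from less.hyps[OF deg this, unfolded QK, OF H0]
    have H: "Const r * (Q - K) \<in> sym_ideal gs" .
    have PG: "Const r * (P + Const f * G) \<in> sym_ideal gs"
      using 0 P G by (intro J polys_add polys_mult)
        (auto simp: rees_map.hom_add rees_map.hom_mult rees_map_Const)
    \<comment> \<open>The replacement of \<open>f G\<close> by \<open>y K\<close> is a combination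
      of exchange relations with the coefficients \<open>F i\<close>.\<close>
    have "Const f * G - y * K = (\<Sum>i<n. F i * (Const f * Var i - Const (fs ! i) * y))"
      by (simp add: GF K_def sum_distrib_left algebra_simps flip: sum_subtractf)
    also have "\<dots> \<in> sym_ideal gs"
      using exchange_sym F polys_Suc_mem
      by (intro ideal_of_sum[OF ideal_sym] sym_mult) (auto simp: y_def simp flip: nth_gs)
    finally have E: "Const f * G - y * K \<in> sym_ideal gs" .
    have "Const r * poly p (Var n) =
        Const r * (P + Const f * G) + (y * (Const r * (Q - K)) - Const r * (Const f * G - y * K))"
      by (simp add: py algebra_simps)
    also have "\<dots> \<in> sym_ideal gs"
      by (rule sym_add[OF PG ideal_of_diff[OF subring_of_polys ideal_sym
            sym_mult[OF y H] sym_mult[OF polys_Const E]]])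
    finally show ?thesis .
  qed
qed

lemma conductor_wrt_append:
  assumes "gen_ideal (set fs) = I" "\<And>j. colon (ideal_pow I j) f = ideal_pow I j"
  shows "conductor_wrt fs \<subseteq> conductor_wrt gs"
proof
  fix r assume r: "r \<in> conductor_wrt fs"
  show "r \<in> conductor_wrt gs"
    unfolding conductor_wrt_def
  proof (intro CollectI ballI)
    fix P assume "P \<in> rees_ideal gs"
    then have "P \<in> adjoin (polys n) (Var n)" "rees_map gs P = 0"
      by (auto simp: rees_ideal_def length_gs polys_Suc)
    then show "Const r * P \<in> sym_ideal gs"
      using conductor_wrt_mult_mem[OF assms r] by (auto simp: adjoin_def)
  qed
qed

text \<open>Modulo the linear relations \<open>f y\<^sub>i - f\<^sub>i y\<close>, multiplication by powers of \<open>f\<close> turns every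
  polynomial into one in \<open>y\<close> alone.\<close>

lemma power_mult_eq_adjoin:
  assumes "P \<in> polys (Suc n)"
  shows "\<exists>k. \<exists>E\<in>adjoin (polys 0) (Var n). Const f ^ k * P - E \<in> sym_ideal gs"
proof -
  note S = subring_of_polys[of 0]
  let ?A = "adjoin (polys 0) (Var n :: 'a mpoly)"
  have A: "E \<in> polys (Suc n)" if "E \<in> ?A" for E
    using that polys_mono[of 0 "Suc n"] by (force simp: adjoin_def intro!: polys_poly polys_Var)
  note D = ideal_of_zero[OF ideal_sym]
  have "P \<in> polys (Suc n) \<and> (\<exists>k. \<exists>E\<in>?A. Const f ^ k * P - E \<in> sym_ideal gs)"
    using assms
  proof (rule mpoly_closure)
    fix c show "Const c \<in> polys (Suc n) \<and> (\<exists>k. \<exists>E\<in>?A. Const f ^ k * Const c - E \<in> sym_ideal gs)"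
      using D by (auto intro!: exI[of _ 0] bexI[of _ "Const c"] adjoin_base[OF S])
  next
    fix i assume "i < Suc n"
    then show "Var i \<in> polys (Suc n) \<and> (\<exists>k. \<exists>E\<in>?A. Const f ^ k * Var i - E \<in> sym_ideal gs)"
      using exchange_sym[of i] adjoin_mult[OF S adjoin_base[OF S polys_Const] adjoin_var[OF S]]
      by (auto intro!: polys_Var exI[of _ 1] bexI[of _ "Const (gs ! i) * Var n"])
  next
    fix p q
    assume "p \<in> polys (Suc n) \<and> (\<exists>k. \<exists>E\<in>?A. Const f ^ k * p - E \<in> sym_ideal gs)"
      "q \<in> polys (Suc n) \<and> (\<exists>k. \<exists>E\<in>?A. Const f ^ k * q - E \<in> sym_ideal gs)"
    then obtain k E l F where p: "p \<in> polys (Suc n)" "E \<in> ?A" "Const f ^ k * p - E \<in> sym_ideal gs"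
      and q: "q \<in> polys (Suc n)" "F \<in> ?A" "Const f ^ l * q - F \<in> sym_ideal gs" by blast
    have f: "Const f ^ j \<in> polys m" for j m by (intro polys_power polys_Const)
    have "Const f ^ (k + l) * (p + q) - (Const f ^ l * E + Const f ^ k * F) =
        Const f ^ l * (Const f ^ k * p - E) + Const f ^ k * (Const f ^ l * q - F)"
      by (simp add: algebra_simps power_add)
    also have "\<dots> \<in> sym_ideal gs"
      using p q f by (intro sym_add sym_mult)
    finally have "Const f ^ (k + l) * (p + q) - (Const f ^ l * E + Const f ^ k * F) \<in> sym_ideal gs" .
    moreover have "Const f ^ l * E + Const f ^ k * F \<in> ?A"
      using p q adjoin_base[OF S f] by (intro adjoin_add[OF S] adjoin_mult[OF S])
    ultimately show "p + q \<in> polys (Suc n) \<and> (\<exists>k. \<exists>E\<in>?A. Const f ^ k * (p + q) - E \<in> sym_ideal gs)"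
      using polys_add[OF p(1) q(1)] by blast
    have "Const f ^ (k + l) * (p * q) - E * F =
        (Const f ^ k * p) * (Const f ^ l * q - F) + F * (Const f ^ k * p - E)"
      by (simp add: algebra_simps power_add)
    also have "\<dots> \<in> sym_ideal gs"
      using p q f A by (intro sym_add sym_mult polys_mult)
    finally have "Const f ^ (k + l) * (p * q) - E * F \<in> sym_ideal gs" .
    moreover have "E * F \<in> ?A"
      using p q by (intro adjoin_mult[OF S])
    ultimately show "p * q \<in> polys (Suc n) \<and> (\<exists>k. \<exists>E\<in>?A. Const f ^ k * (p * q) - E \<in> sym_ideal gs)"
      using polys_mult[OF p(1) q(1)] by blast
  qed
  then show ?thesis by blast
qed

text \<open>The terms of a polynomial in the single variable \<open>Var n\<close> land in different
  degrees of \<open>R[t]\<close> and cannot cancel. So \<open>f ^ i\<close> kills the coefficient of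
  degree \<open>i\<close>, and the power for the top degree kills them all.\<close>

lemma power_mult_adjoin_eq_0:
  assumes "E \<in> adjoin (polys 0) (Var n)" "rees_map gs E = 0"
  shows "\<exists>k. Const f ^ k * E = 0"
proof -
  obtain q where q: "E = poly q (Var n)" "\<forall>i. coeff q i \<in> range Const"
    using assms(1) by (auto simp: adjoin_def polys_0)
  then have "\<forall>i. \<exists>c. coeff q i = Const c" by blast
  then obtain c where c: "\<And>i. coeff q i = Const (c i)" by metis
  have E: "E = (\<Sum>i\<le>degree q. Const (c i) * Var n ^ i)"
    by (simp add: q(1) poly_altdef c)
  have "rees_map gs (Const (c i) * Var n ^ i) = monom (c i * f ^ i) i" for i
    by (simp add: rees_map.hom_mult rees_map.hom_power rees_map_Const rees_map_Var
        nth_gs(2) monom_power smult_monom)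
  then have "rees_map gs E = (\<Sum>i\<le>degree q. monom (c i * f ^ i) i)"
    by (simp only: E rees_map.hom_sum)
  then have 0: "(\<Sum>i\<le>degree q. monom (c i * f ^ i) i) = 0" using assms(2) by simp
  have cf: "c j * f ^ j = 0" if "j \<le> degree q" for j
    using arg_cong[OF 0, of "\<lambda>u. coeff u j"] that by (simp add: coeff_sum coeff_monom)
  have "Const f ^ degree q * (Const (c j) * Var n ^ j) = 0" if "j \<le> degree q" for j
  proof -
    have "f ^ degree q * c j = f ^ (degree q - j) * (c j * f ^ j)"
      using that by (simp add: mult_ac flip: power_add)
    then have "Const f ^ degree q * Const (c j) = 0"
      using cf[OF that] by (simp add: Const.hom_zero flip: Const.hom_power Const_mult)
    then show ?thesis by (simp flip: mult.assoc)
  qed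
  then have "Const f ^ degree q * E = 0"
    unfolding E sum_distrib_left by simp
  then show ?thesis ..
qed

text \<open>After reduction to one variable, the remainder \<open>E\<close> is again a relation,
  because linear relations generate relations; a further power of \<open>f\<close> annihilates
  it.\<close>

lemma power_mult_mem:
  assumes "P \<in> rees_ideal gs"
  shows "\<exists>k. Const f ^ k * P \<in> sym_ideal gs"
proof -
  have P: "P \<in> polys (Suc n)" "rees_map gs P = 0"
    using assms by (auto simp: rees_ideal_def length_gs)
  obtain k E where E: "E \<in> adjoin (polys 0) (Var n)" "Const f ^ k * P - E \<in> sym_ideal gs"
    using power_mult_eq_adjoin[OF P(1)] by blast
  have "rees_map gs (Const f ^ k * P - E) = 0"
    using E(2) sym_ideal_subset_rees_ideal by (auto simp: rees_ideal_def)
  then have "rees_map gs E = 0"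
    by (simp add: rees_map.hom_diff rees_map.hom_mult P)
  then obtain l where "Const f ^ l * E = 0"
    using power_mult_adjoin_eq_0[OF E(1)] by blast
  then have "Const f ^ (l + k) * P = Const f ^ l * (Const f ^ k * P - E)"
    by (simp add: algebra_simps power_add)
  also have "\<dots> \<in> sym_ideal gs"
    by (intro sym_mult E polys_power polys_Const)
  finally show ?thesis ..
qed

text \<open>The exponent from \<open>power_mult_mem\<close> depends on the relation. Finitely many
  generators of \<open>rees_ideal gs\<close> admit a common one.\<close>

lemma power_in_conductor_wrt:
  assumes "noetherian TYPE('a)"
  shows "\<exists>k>0. f ^ k \<in> conductor_wrt gs"
proof -
  have J: "ideal_of (polys (Suc n)) (rees_ideal gs)"
    by (auto simp: ideal_of_def rees_ideal_def length_gs polys_add polys_mult rees_map.hom_zero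
        rees_map.hom_add rees_map.hom_mult)
  from noetherian_on_polys[OF assms, unfolded noetherian_on_def, rule_format, OF this]
  obtain S where S: "finite S" "S \<subseteq> rees_ideal gs"
    "gen_ideal_of (polys (Suc n)) S = rees_ideal gs" by blast
  obtain e where e: "\<And>P. P \<in> S \<Longrightarrow> Const f ^ e P * P \<in> sym_ideal gs"
    using power_mult_mem S(2) by (metis subsetD)
  \<comment> \<open>The sum bounds each exponent, and \<open>Suc\<close> makes \<open>k\<close>
    positive.\<close>
  define k where "k = Suc (\<Sum>P\<in>S. e P)"
  let ?A = "{P \<in> polys (Suc n). Const (f ^ k) * P \<in> sym_ideal gs}"
  have "rees_ideal gs \<subseteq> ?A"
    unfolding S(3)[symmetric]
  proof (rule gen_ideal_of_minimal)
    show "S \<subseteq> ?A"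
    proof
      fix P assume P: "P \<in> S"
      have "e P \<le> k" using member_le_sum[of P S e] S(1) P by (simp add: k_def)
      then have "Const (f ^ k) * P = Const (f ^ (k - e P)) * (Const f ^ e P * P)"
        by (simp add: Const.hom_power flip: mult.assoc power_add)
      then have "Const (f ^ k) * P \<in> sym_ideal gs"
        using sym_mult[OF polys_Const e[OF P]] by simp
      then show "P \<in> ?A" using P S(2) J by (auto simp: ideal_of_def)
    qed
    show "ideal_of (polys (Suc n)) ?A"
      unfolding ideal_of_def
      using ideal_of_zero[OF ideal_sym]
      by (auto simp: distrib_left mult.left_commute[of "Const _"] intro: polys_add polys_mult sym_add sym_mult)
  qed
  then have "f ^ k \<in> conductor_wrt gs" by (auto simp: conductor_wrt_def)
  then show ?thesis by (auto simp: k_def)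
qed

end

section \<open>From lists of generators to ideals\<close>

lemma is_ideal_conductor_wrt: "is_ideal (conductor_wrt fs)"
  using ideal_of_sym_ideal[of fs]
  by (auto simp: ideal_of_def conductor_wrt_def Const_add Const_mult Const.hom_zero distrib_right mult.assoc)

theorem theorem2p3:
  fixes I :: "'a::comm_ring_1 set" and f :: 'a
  assumes "noetherian TYPE('a)"
    and "is_ideal I"
    and "\<And>j. colon (ideal_pow I j) f = ideal_pow I j"
  shows "\<exists>k>0. gen_ideal (conductor I \<union> {f ^ k}) \<subseteq> conductor (gen_ideal (I \<union> {f}))"
proof -
  obtain S where "finite S" "gen_ideal S = I"
    using assms(1,2) by (auto simp: noetherian_def)
  then obtain fs where fs: "gen_ideal (set fs) = I"
    using finite_list by blast
  \<comment> \<open>This lets \<open>conductor_eq\<close> compute the conductor of the larger ideal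
    with the list \<open>fs @ [f]\<close>, in place of the arbitrary choice in its
    definition.\<close>
  have If: "gen_ideal (set (fs @ [f])) = gen_ideal (I \<union> {f})"
  proof
    have "set fs \<subseteq> I" using fs gen_ideal_of_superset[of "set fs" UNIV] by simp
    then have "set (fs @ [f]) \<subseteq> gen_ideal (I \<union> {f})"
      using gen_ideal_of_superset[of "I \<union> {f}" UNIV] by auto
    then show "gen_ideal (set (fs @ [f])) \<subseteq> gen_ideal (I \<union> {f})"
      by (rule gen_ideal_of_minimal[OF _ is_ideal_gen_ideal])
    have "set (fs @ [f]) \<subseteq> gen_ideal (set (fs @ [f]))" by (rule gen_ideal_of_superset)
    moreover from this have "gen_ideal (set fs) \<subseteq> gen_ideal (set (fs @ [f]))"
      by (intro gen_ideal_of_minimal is_ideal_gen_ideal) auto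
    ultimately have "I \<union> {f} \<subseteq> gen_ideal (set (fs @ [f]))" using fs by auto
    then show "gen_ideal (I \<union> {f}) \<subseteq> gen_ideal (set (fs @ [f]))"
      by (rule gen_ideal_of_minimal[OF _ is_ideal_gen_ideal])
  qed
  obtain k where "k > 0" and k: "f ^ k \<in> conductor_wrt (fs @ [f])"
    using power_in_conductor_wrt[OF assms(1)] by blast
  \<comment> \<open>The target is an ideal, so it is enough to place \<open>conductor I\<close> and
    \<open>f ^ k\<close> in it.\<close>
  have "gen_ideal (conductor I \<union> {f ^ k}) \<subseteq> conductor_wrt (fs @ [f])"
    using conductor_wrt_append[OF fs assms(3)] k
    by (intro gen_ideal_of_minimal is_ideal_conductor_wrt) (simp add: conductor_eq[OF fs])
  then show ?thesis
    using \<open>k > 0\<close> conductor_eq[OF If] by auto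
qed

end
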